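(* Let $T$ be a Stone KAN-algebra. Then the centered Stone KAN-algebras $M(T)$ and $K(T^{\lozenge})$ are isomorphic.
   Context: A Kleene algebra is an algebra $\langle T,\vee,\wedge,\sim,0,1\rangle$ whose reduct $\langle T,\vee,\wedge,0,1\rangle$ is a bounded distributive lattice and such that $\sim\sim x=x$, $\sim(x\vee y)=\sim x\wedge\sim y$ and $x\wedge\sim x\le y\vee\sim y$ for all $x,y$. A KAN-algebra is an algebra $\langle T,\vee,\wedge,\sim,\neg,0,1\rangle$ of type $(2,2,1,1,0,0)$ whose $\neg$-free reduct is a Kleene algebra and which satisfies: (N1) $\neg(x\wedge\neg(x\wedge y))=\neg(x\wedge\neg y)$; (N2) $\neg(x\vee y)=\neg x\wedge\neg y$; (N3) $x\wedge\sim x=x\wedge\neg x$; (N4) $\sim x\le\neg x$; (N5) $\neg(x\wedge y)=\neg((\sim\neg x)\wedge y)$. A centered KAN-algebra is an algebra $\langle T,\vee,\wedge,\sim,\neg,c,0,1\rangle$ where $\langle T,\vee,\wedge,\sim,\neg,0,1\rangle$ is a KAN-algebra and the constant $c$ (the center) satisfies $\sim c=c$. A Stone KAN-algebra is a KAN-algebra satisfying $\neg x\vee\neg\neg x=1$ for all $x$; a centered Stone KAN-algebra is a centered KAN-algebra satisfying this same equation. Notation: $\lozenge x:=\sim\neg x$, $\square x:=\neg\sim x$, $T^{\lozenge}:=\{x\in T:\lozenge x=x\}$, $T^{\square}:=\{x\in T:\square x=x\}$. $T^{\lozenge}$ is regarded as the Stone algebra $\langle T^{\lozenge},\vee,\wedge^{\lozenge},\neg^{\lozenge},0,1\rangle$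 with $x\wedge^{\lozenge}y:=\lozenge(x\wedge y)$ and pseudocomplement $\neg^{\lozenge}x:=\lozenge\neg x$. (A Stone algebra is a bounded distributive lattice with a pseudocomplement ${}^{\ast}$, i.e. $a\wedge b=0$ iff $a\le b^{\ast}$, satisfying $x^{\ast}\vee x^{\ast\ast}=1$.) For a Stone algebra $\langle A,\vee,\wedge,{}^{\ast},0,1\rangle$, $K(A):=\{(x,y)\in A\times A: x\wedge y=0\}$ (the meet being that of $A$) is the centered Stone KAN-algebra with $(a,b)\vee(d,e)=(a\vee d,b\wedge e)$, $(a,b)\wedge(d,e)=(a\wedge d,b\vee e)$, $\sim(a,b)=(b,a)$, $\neg(a,b)=(a^{\ast},a)$, bottom $(0,1)$, top $(1,0)$, center $(0,0)$. $M(T):=\{(x,y)\in T^{\lozenge}\times T^{\square}: x\le y\}$ is the centered Stone KAN-algebra with join $(a,b)\cup(d,e):=(a\vee d,\square(b\vee e))$, meet $(a,b)\cap(d,e):=(\lozenge(a\wedge d),b\wedge e)$, $\approx(a,b):=(\sim b,\sim a)$ in the role of $\sim$, $\circledast(a,b):=(\lozenge\neg a,\sim a)$ in the role of $\neg$, bottom $(0,0)$, top $(1,1)$, center $(0,1)$. *)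

theory Defs
  imports Main "HOL-Algebra.Congruence"
begin

text \<open>
  Algebras are carrier-based records in the style of HOL-Algebra. Because the carriers of the
  derived algebras are proper subsets of a type, all laws are relativised to the carrier, and closure
  of the carrier under the operations is part of the axioms.
\<close>

record 'a blat = "'a partial_object" +
  join :: "'a \<Rightarrow> 'a \<Rightarrow> 'a" (infixl \<open>\<squnion>\<index>\<close> 65)
  meet :: "'a \<Rightarrow> 'a \<Rightarrow> 'a" (infixl \<open>\<sqinter>\<index>\<close> 70)
  bottom :: 'a (\<open>\<bottom>\<index>\<close>)
  top_el :: 'a (\<open>\<top>\<index>\<close>)

definition lat_le :: "('a, 'm) blat_scheme \<Rightarrow> 'a \<Rightarrow> 'a \<Rightarrow> bool" (infix \<open>\<sqsubseteq>\<index>\<close> 50)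
  where "x \<sqsubseteq>\<^bsub>L\<^esub> y \<longleftrightarrow> x \<sqinter>\<^bsub>L\<^esub> y = x"

locale bounded_distrib_lattice =
  fixes L :: "('a, 'm) blat_scheme" (structure)
  assumes bottom_closed: "\<bottom> \<in> carrier L"
    and top_closed: "\<top> \<in> carrier L"
    and join_closed: "\<lbrakk>x \<in> carrier L; y \<in> carrier L\<rbrakk> \<Longrightarrow> x \<squnion> y \<in> carrier L"
    and meet_closed: "\<lbrakk>x \<in> carrier L; y \<in> carrier L\<rbrakk> \<Longrightarrow> x \<sqinter> y \<in> carrier L"
    and join_comm: "\<lbrakk>x \<in> carrier L; y \<in> carrier L\<rbrakk> \<Longrightarrow> x \<squnion> y = y \<squnion> x"
    and meet_comm: "\<lbrakk>x \<in> carrier L; y \<in> carrier L\<rbrakk> \<Longrightarrow> x \<sqinter> y = y \<sqinter> x"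
    and join_assoc: "\<lbrakk>x \<in> carrier L; y \<in> carrier L; z \<in> carrier L\<rbrakk>
      \<Longrightarrow> (x \<squnion> y) \<squnion> z = x \<squnion> (y \<squnion> z)"
    and meet_assoc: "\<lbrakk>x \<in> carrier L; y \<in> carrier L; z \<in> carrier L\<rbrakk>
      \<Longrightarrow> (x \<sqinter> y) \<sqinter> z = x \<sqinter> (y \<sqinter> z)"
    and join_absorb: "\<lbrakk>x \<in> carrier L; y \<in> carrier L\<rbrakk> \<Longrightarrow> x \<squnion> (x \<sqinter> y) = x"
    and meet_absorb: "\<lbrakk>x \<in> carrier L; y \<in> carrier L\<rbrakk> \<Longrightarrow> x \<sqinter> (x \<squnion> y) = x"
    and meet_join_distrib: "\<lbrakk>x \<in> carrier L; y \<in> carrier L; z \<in> carrier L\<rbrakk>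
      \<Longrightarrow> x \<sqinter> (y \<squnion> z) = (x \<sqinter> y) \<squnion> (x \<sqinter> z)"
    and bottom_le: "x \<in> carrier L \<Longrightarrow> \<bottom> \<sqsubseteq> x"
    and le_top: "x \<in> carrier L \<Longrightarrow> x \<sqsubseteq> \<top>"

record 'a stone_alg = "'a blat" +
  pcomp :: "'a \<Rightarrow> 'a"

locale stone_algebra = bounded_distrib_lattice A
  for A :: "('a, 'm) stone_alg_scheme" (structure) +
  assumes pcomp_closed: "x \<in> carrier A \<Longrightarrow> pcomp A x \<in> carrier A"
    and pcomp_iff: "\<lbrakk>a \<in> carrier A; b \<in> carrier A\<rbrakk> \<Longrightarrow> a \<sqinter> b = \<bottom> \<longleftrightarrow> a \<sqsubseteq> pcomp A b"
    and stone: "x \<in> carrier A \<Longrightarrow> pcomp A x \<squnion> pcomp A (pcomp A x) = \<top>"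

record 'a kleene_alg = "'a blat" +
  inv_neg :: "'a \<Rightarrow> 'a" (\<open>\<sim>\<index> _\<close> [81] 80)

locale kleene_algebra = bounded_distrib_lattice T
  for T :: "('a, 'm) kleene_alg_scheme" (structure) +
  assumes inv_closed: "x \<in> carrier T \<Longrightarrow> \<sim> x \<in> carrier T"
    and inv_inv: "x \<in> carrier T \<Longrightarrow> \<sim> (\<sim> x) = x"
    and inv_join: "\<lbrakk>x \<in> carrier T; y \<in> carrier T\<rbrakk> \<Longrightarrow> \<sim> (x \<squnion> y) = \<sim> x \<sqinter> \<sim> y"
    and kleene: "\<lbrakk>x \<in> carrier T; y \<in> carrier T\<rbrakk> \<Longrightarrow> x \<sqinter> \<sim> x \<sqsubseteq> y \<squnion> \<sim> y"

record 'a kan_alg = "'a kleene_alg" +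
  kan_neg :: "'a \<Rightarrow> 'a" (\<open>\<rightharpoondown>\<index> _\<close> [81] 80)

locale kan_algebra = kleene_algebra T
  for T :: "('a, 'm) kan_alg_scheme" (structure) +
  assumes neg_closed: "x \<in> carrier T \<Longrightarrow> \<rightharpoondown> x \<in> carrier T"
    and N1: "\<lbrakk>x \<in> carrier T; y \<in> carrier T\<rbrakk> \<Longrightarrow> \<rightharpoondown> (x \<sqinter> \<rightharpoondown> (x \<sqinter> y)) = \<rightharpoondown> (x \<sqinter> \<rightharpoondown> y)"
    and N2: "\<lbrakk>x \<in> carrier T; y \<in> carrier T\<rbrakk> \<Longrightarrow> \<rightharpoondown> (x \<squnion> y) = \<rightharpoondown> x \<sqinter> \<rightharpoondown> y"
    and N3: "x \<in> carrier T \<Longrightarrow> x \<sqinter> \<sim> x = x \<sqinter> \<rightharpoondown> x"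
    and N4: "x \<in> carrier T \<Longrightarrow> \<sim> x \<sqsubseteq> \<rightharpoondown> x"
    and N5: "\<lbrakk>x \<in> carrier T; y \<in> carrier T\<rbrakk> \<Longrightarrow> \<rightharpoondown> (x \<sqinter> y) = \<rightharpoondown> ((\<sim> (\<rightharpoondown> x)) \<sqinter> y)"

locale stone_kan_algebra = kan_algebra T
  for T :: "('a, 'm) kan_alg_scheme" (structure) +
  assumes stone_neg: "x \<in> carrier T \<Longrightarrow> \<rightharpoondown> x \<squnion> \<rightharpoondown> (\<rightharpoondown> x) = \<top>"

record 'a ckan_alg = "'a kan_alg" +
  center :: 'a (\<open>\<cc>\<index>\<close>)

locale centered_kan_algebra = kan_algebra T
  for T :: "('a, 'm) ckan_alg_scheme" (structure) +
  assumes center_closed: "\<cc> \<in> carrier T"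
    and inv_center: "\<sim> \<cc> = \<cc>"

locale centered_stone_kan_algebra = centered_kan_algebra T + stone_kan_algebra T
  for T :: "('a, 'm) ckan_alg_scheme" (structure)

definition ckan_iso :: "('a, 'm) ckan_alg_scheme \<Rightarrow> ('b, 'n) ckan_alg_scheme \<Rightarrow> ('a \<Rightarrow> 'b) set"
  where "ckan_iso A B = {h. bij_betw h (carrier A) (carrier B) \<and>
    (\<forall>x\<in>carrier A. \<forall>y\<in>carrier A. h (x \<squnion>\<^bsub>A\<^esub> y) = h x \<squnion>\<^bsub>B\<^esub> h y) \<and>
    (\<forall>x\<in>carrier A. \<forall>y\<in>carrier A. h (x \<sqinter>\<^bsub>A\<^esub> y) = h x \<sqinter>\<^bsub>B\<^esub> h y) \<and>
    (\<forall>x\<in>carrier A. h (\<sim>\<^bsub>A\<^esub> x) = \<sim>\<^bsub>B\<^esub> (h x)) \<and>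
    (\<forall>x\<in>carrier A. h (\<rightharpoondown>\<^bsub>A\<^esub> x) = \<rightharpoondown>\<^bsub>B\<^esub> (h x)) \<and>
    h \<cc>\<^bsub>A\<^esub> = \<cc>\<^bsub>B\<^esub> \<and> h \<bottom>\<^bsub>A\<^esub> = \<bottom>\<^bsub>B\<^esub> \<and> h \<top>\<^bsub>A\<^esub> = \<top>\<^bsub>B\<^esub>}"

definition ckan_isomorphic :: "('a, 'm) ckan_alg_scheme \<Rightarrow> ('b, 'n) ckan_alg_scheme \<Rightarrow> bool"
  where "ckan_isomorphic A B \<longleftrightarrow> ckan_iso A B \<noteq> {}"

definition dia :: "('a, 'm) kan_alg_scheme \<Rightarrow> 'a \<Rightarrow> 'a" (\<open>\<diamond>\<index> _\<close> [81] 80)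
  where "\<diamond>\<^bsub>T\<^esub> x = \<sim>\<^bsub>T\<^esub> (\<rightharpoondown>\<^bsub>T\<^esub> x)"

definition box :: "('a, 'm) kan_alg_scheme \<Rightarrow> 'a \<Rightarrow> 'a" (\<open>\<box>\<index> _\<close> [81] 80)
  where "\<box>\<^bsub>T\<^esub> x = \<rightharpoondown>\<^bsub>T\<^esub> (\<sim>\<^bsub>T\<^esub> x)"

definition dia_set :: "('a, 'm) kan_alg_scheme \<Rightarrow> 'a set"
  where "dia_set T = {x \<in> carrier T. \<diamond>\<^bsub>T\<^esub> x = x}"

definition box_set :: "('a, 'm) kan_alg_scheme \<Rightarrow> 'a set"
  where "box_set T = {x \<in> carrier T. \<box>\<^bsub>T\<^esub> x = x}"

definition dia_algebra :: "('a, 'm) kan_alg_scheme \<Rightarrow> 'a stone_alg"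
  where "dia_algebra T = \<lparr>
    carrier = dia_set T,
    join = (\<lambda>x y. x \<squnion>\<^bsub>T\<^esub> y),
    meet = (\<lambda>x y. \<diamond>\<^bsub>T\<^esub> (x \<sqinter>\<^bsub>T\<^esub> y)),
    bottom = \<bottom>\<^bsub>T\<^esub>,
    top_el = \<top>\<^bsub>T\<^esub>,
    pcomp = (\<lambda>x. \<diamond>\<^bsub>T\<^esub> (\<rightharpoondown>\<^bsub>T\<^esub> x))\<rparr>"

definition K_algebra :: "('a, 'm) stone_alg_scheme \<Rightarrow> ('a \<times> 'a) ckan_alg"
  where "K_algebra A = \<lparr>
    carrier = {(x, y). x \<in> carrier A \<and> y \<in> carrier A \<and> x \<sqinter>\<^bsub>A\<^esub> y = \<bottom>\<^bsub>A\<^esub>},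
    join = (\<lambda>(a, b) (d, e). (a \<squnion>\<^bsub>A\<^esub> d, b \<sqinter>\<^bsub>A\<^esub> e)),
    meet = (\<lambda>(a, b) (d, e). (a \<sqinter>\<^bsub>A\<^esub> d, b \<squnion>\<^bsub>A\<^esub> e)),
    bottom = (\<bottom>\<^bsub>A\<^esub>, \<top>\<^bsub>A\<^esub>),
    top_el = (\<top>\<^bsub>A\<^esub>, \<bottom>\<^bsub>A\<^esub>),
    inv_neg = (\<lambda>(a, b). (b, a)),
    kan_neg = (\<lambda>(a, b). (pcomp A a, a)),
    center = (\<bottom>\<^bsub>A\<^esub>, \<bottom>\<^bsub>A\<^esub>)\<rparr>"

definition M_algebra :: "('a, 'm) kan_alg_scheme \<Rightarrow> ('a \<times> 'a) ckan_alg"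
  where "M_algebra T = \<lparr>
    carrier = {(x, y). x \<in> dia_set T \<and> y \<in> box_set T \<and> x \<sqsubseteq>\<^bsub>T\<^esub> y},
    join = (\<lambda>(a, b) (d, e). (a \<squnion>\<^bsub>T\<^esub> d, \<box>\<^bsub>T\<^esub> (b \<squnion>\<^bsub>T\<^esub> e))),
    meet = (\<lambda>(a, b) (d, e). (\<diamond>\<^bsub>T\<^esub> (a \<sqinter>\<^bsub>T\<^esub> d), b \<sqinter>\<^bsub>T\<^esub> e)),
    bottom = (\<bottom>\<^bsub>T\<^esub>, \<bottom>\<^bsub>T\<^esub>),
    top_el = (\<top>\<^bsub>T\<^esub>, \<top>\<^bsub>T\<^esub>),
    inv_neg = (\<lambda>(a, b). (\<sim>\<^bsub>T\<^esub> b, \<sim>\<^bsub>T\<^esub> a)),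
    kan_neg = (\<lambda>(a, b). (\<diamond>\<^bsub>T\<^esub> (\<rightharpoondown>\<^bsub>T\<^esub> a), \<sim>\<^bsub>T\<^esub> a)),
    center = (\<bottom>\<^bsub>T\<^esub>, \<top>\<^bsub>T\<^esub>)\<rparr>"

end

theory Submission
  imports Defs
begin

text \<open>
  The operator \<open>\<diamond> x = \<sim> \<rightharpoondown> x\<close> is an interior operator: (N4) gives
  \<open>\<diamond> x \<sqsubseteq> x\<close> and (N5) gives \<open>\<rightharpoondown> \<diamond> x = \<rightharpoondown> x\<close>, hence idempotence. By (N2) it
  preserves joins, and (N5) says \<open>\<diamond> (\<diamond> x \<sqinter> y) = \<diamond> (x \<sqinter> y)\<close>. So \<open>\<diamond> x = \<diamond> y\<close> is
  a lattice congruence on \<open>T\<close>, and \<open>dia_algebra T\<close> is the quotient, each class being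
  represented by its least element. In this quotient \<open>\<rightharpoondown>\<close> is a pseudocomplement; that is
  the content of (N1). This gives \<open>dia_algebra_stone\<close>.

  The isomorphism from \<open>M_algebra T\<close> to \<open>K_algebra (dia_algebra T)\<close> is
  \<open>(a, b) \<mapsto> (a, \<sim> b)\<close>. As \<open>\<sim>\<close> exchanges the fixed points of \<open>\<box>\<close> with those of
  \<open>\<diamond>\<close> and intertwines the two operators, the operations match at once. What remains is
  that the order constraint \<open>a \<sqsubseteq> b\<close> on the pairs of the former matches the
  disjointness constraint \<open>\<diamond> (a \<sqinter> \<sim> b) = \<bottom>\<close> on the pairs of the latter. This is
  \<open>le_iff_dia_meet_inv\<close>, which rests on (N1) and on (N3), the axiom that relates the two
  negations.

  That \<open>K_algebra A\<close> is a centered Stone KAN-algebra for every Stone algebra \<open>A\<close> is a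
  computation with pairs (\<open>K_algebra_centered_stone_kan\<close>). For \<open>M_algebra T\<close> the same
  property comes with the isomorphism: its operations are those of \<open>K_algebra (dia_algebra T)\<close>
  carried over along the bijection, and the axioms are carried over with them
  (\<open>transport_centered_stone_kan\<close>).
\<close>

section \<open>Order in a bounded distributive lattice\<close>

context bounded_distrib_lattice
begin

lemmas closed [simp] = bottom_closed top_closed join_closed meet_closed

lemma meet_idem [simp]: "x \<in> carrier L \<Longrightarrow> x \<sqinter> x = x"
  by (metis join_absorb meet_absorb meet_closed)

lemma join_idem [simp]: "x \<in> carrier L \<Longrightarrow> x \<squnion> x = x"
  by (metis join_absorb meet_idem)

lemma meet_bottom [simp]:
  "x \<in> carrier L \<Longrightarrow> \<bottom> \<sqinter> x = \<bottom>" "x \<in> carrier L \<Longrightarrow> x \<sqinter> \<bottom> = \<bottom>"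
  using bottom_le meet_comm by (auto simp: lat_le_def)

lemma meet_top [simp]:
  "x \<in> carrier L \<Longrightarrow> x \<sqinter> \<top> = x" "x \<in> carrier L \<Longrightarrow> \<top> \<sqinter> x = x"
  using le_top meet_comm by (auto simp: lat_le_def)

lemma join_bottom [simp]:
  "x \<in> carrier L \<Longrightarrow> x \<squnion> \<bottom> = x" "x \<in> carrier L \<Longrightarrow> \<bottom> \<squnion> x = x"
  by (metis bottom_closed join_absorb join_comm meet_bottom(2))+

lemma join_top [simp]:
  "x \<in> carrier L \<Longrightarrow> x \<squnion> \<top> = \<top>" "x \<in> carrier L \<Longrightarrow> \<top> \<squnion> x = \<top>"
  by (metis join_absorb join_comm meet_top(2) top_closed)+

lemma le_refl: "x \<in> carrier L \<Longrightarrow> x \<sqsubseteq> x"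
  by (simp add: lat_le_def)

lemma le_trans:
  "\<lbrakk>x \<sqsubseteq> y; y \<sqsubseteq> z; x \<in> carrier L; y \<in> carrier L; z \<in> carrier L\<rbrakk> \<Longrightarrow> x \<sqsubseteq> z"
  unfolding lat_le_def by (metis meet_assoc)

lemma le_antisym: "\<lbrakk>x \<sqsubseteq> y; y \<sqsubseteq> x; x \<in> carrier L; y \<in> carrier L\<rbrakk> \<Longrightarrow> x = y"
  unfolding lat_le_def by (metis meet_comm)

lemma eq_if_same_lower_bounds:
  assumes "x \<in> carrier L" "y \<in> carrier L"
    and "\<And>z. z \<in> carrier L \<Longrightarrow> z \<sqsubseteq> x \<longleftrightarrow> z \<sqsubseteq> y"
  shows "x = y"
  using assms le_refl le_antisym by blast

lemma meet_le:
  assumes "x \<in> carrier L" "y \<in> carrier L"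
  shows "x \<sqinter> y \<sqsubseteq> x" and "x \<sqinter> y \<sqsubseteq> y"
proof -
  show "x \<sqinter> y \<sqsubseteq> y" using assms by (simp add: lat_le_def meet_assoc)
  with assms show "x \<sqinter> y \<sqsubseteq> x"
    by (metis lat_le_def meet_assoc meet_comm meet_idem)
qed

lemma le_meet_iff:
  assumes "x \<in> carrier L" "y \<in> carrier L" "z \<in> carrier L"
  shows "z \<sqsubseteq> x \<sqinter> y \<longleftrightarrow> z \<sqsubseteq> x \<and> z \<sqsubseteq> y"
proof
  assume "z \<sqsubseteq> x \<sqinter> y"
  with assms meet_le le_trans show "z \<sqsubseteq> x \<and> z \<sqsubseteq> y" by (meson meet_closed)
next
  assume "z \<sqsubseteq> x \<and> z \<sqsubseteq> y"
  with assms show "z \<sqsubseteq> x \<sqinter> y" unfolding lat_le_def by (metis meet_assoc)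
qed

lemma le_iff_join: "\<lbrakk>x \<in> carrier L; y \<in> carrier L\<rbrakk> \<Longrightarrow> x \<sqsubseteq> y \<longleftrightarrow> x \<squnion> y = y"
  unfolding lat_le_def by (metis join_absorb join_comm meet_absorb meet_comm)

lemma join_eq_bottom_iff:
  assumes "x \<in> carrier L" "y \<in> carrier L"
  shows "x \<squnion> y = \<bottom> \<longleftrightarrow> x = \<bottom> \<and> y = \<bottom>"
  using assms by (metis join_bottom(1) join_comm meet_absorb meet_bottom(2) bottom_closed)

lemma meet_join_distrib2:
  assumes "x \<in> carrier L" "y \<in> carrier L" "z \<in> carrier L"
  shows "(y \<squnion> z) \<sqinter> x = (y \<sqinter> x) \<squnion> (z \<sqinter> x)"
  using assms by (metis join_closed meet_comm meet_join_distrib)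

lemma join_meet_distrib:
  assumes "x \<in> carrier L" "y \<in> carrier L" "z \<in> carrier L"
  shows "x \<squnion> (y \<sqinter> z) = (x \<squnion> y) \<sqinter> (x \<squnion> z)"
proof -
  have "(x \<squnion> y) \<sqinter> (x \<squnion> z) = ((x \<squnion> y) \<sqinter> x) \<squnion> ((x \<squnion> y) \<sqinter> z)"
    using assms by (simp add: meet_join_distrib)
  also have "(x \<squnion> y) \<sqinter> x = x"
    using assms by (simp add: meet_absorb meet_comm)
  also have "(x \<squnion> y) \<sqinter> z = (x \<sqinter> z) \<squnion> (y \<sqinter> z)"
    using assms by (simp add: meet_join_distrib2)
  also have "x \<squnion> ((x \<sqinter> z) \<squnion> (y \<sqinter> z)) = x \<squnion> (y \<sqinter> z)"
    using assms by (simp add: join_assoc[symmetric] join_absorb)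
  finally show ?thesis by simp
qed

end

section \<open>Pseudocomplements and pairs of disjoint elements\<close>

context stone_algebra
begin

lemmas pcomp_closed_simp [simp] = pcomp_closed

lemma meet_pcomp:
  assumes "a \<in> carrier A"
  shows "a \<sqinter> pcomp A a = \<bottom>"
  using assms by (metis le_refl meet_comm pcomp_closed pcomp_iff)

lemma le_pcomp_iff:
  "\<lbrakk>a \<in> carrier A; b \<in> carrier A\<rbrakk> \<Longrightarrow> a \<sqsubseteq> pcomp A b \<longleftrightarrow> a \<sqinter> b = \<bottom>"
  by (simp add: pcomp_iff)

lemma pcomp_join:
  assumes [simp]: "a \<in> carrier A" "b \<in> carrier A"
  shows "pcomp A (a \<squnion> b) = pcomp A a \<sqinter> pcomp A b"
  by (rule eq_if_same_lower_bounds)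
    (simp_all add: le_meet_iff le_pcomp_iff meet_join_distrib join_eq_bottom_iff)

lemma meet_pcomp_meet:
  assumes [simp]: "a \<in> carrier A" "b \<in> carrier A"
  shows "a \<sqinter> pcomp A (a \<sqinter> b) = a \<sqinter> pcomp A b"
proof (rule eq_if_same_lower_bounds)
  fix z assume [simp]: "z \<in> carrier A"
  show "z \<sqsubseteq> a \<sqinter> pcomp A (a \<sqinter> b) \<longleftrightarrow> z \<sqsubseteq> a \<sqinter> pcomp A b"
    by (auto simp: le_meet_iff le_pcomp_iff meet_assoc[symmetric]) (simp_all add: lat_le_def)
qed simp_all

lemma K_carrier_iff:
  "(a, b) \<in> carrier (K_algebra A) \<longleftrightarrow> a \<in> carrier A \<and> b \<in> carrier A \<and> a \<sqinter> b = \<bottom>"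
  by (simp add: K_algebra_def)

lemma K_sel [simp]:
  "(a, b) \<squnion>\<^bsub>K_algebra A\<^esub> (d, e) = (a \<squnion> d, b \<sqinter> e)"
  "(a, b) \<sqinter>\<^bsub>K_algebra A\<^esub> (d, e) = (a \<sqinter> d, b \<squnion> e)"
  "\<bottom>\<^bsub>K_algebra A\<^esub> = (\<bottom>, \<top>)"
  "\<top>\<^bsub>K_algebra A\<^esub> = (\<top>, \<bottom>)"
  "\<sim>\<^bsub>K_algebra A\<^esub> (a, b) = (b, a)"
  "\<rightharpoondown>\<^bsub>K_algebra A\<^esub> (a, b) = (pcomp A a, a)"
  "\<cc>\<^bsub>K_algebra A\<^esub> = (\<bottom>, \<bottom>)"
  by (simp_all add: K_algebra_def)

lemma K_join_closed:
  assumes "a \<in> carrier A" "b \<in> carrier A" "d \<in> carrier A" "e \<in> carrier A"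
    "a \<sqinter> b = \<bottom>" "d \<sqinter> e = \<bottom>"
  shows "(a \<squnion> d) \<sqinter> (b \<sqinter> e) = \<bottom>"
proof -
  have "a \<sqinter> (b \<sqinter> e) = \<bottom>"
    using assms by (metis meet_assoc meet_bottom(1))
  moreover have "d \<sqinter> (b \<sqinter> e) = \<bottom>"
    using assms by (metis meet_assoc meet_bottom(1) meet_comm)
  ultimately show ?thesis
    using assms by (simp add: meet_join_distrib2)
qed

lemma K_meet_closed:
  assumes "a \<in> carrier A" "b \<in> carrier A" "d \<in> carrier A" "e \<in> carrier A"
    "a \<sqinter> b = \<bottom>" "d \<sqinter> e = \<bottom>"
  shows "(a \<sqinter> d) \<sqinter> (b \<squnion> e) = \<bottom>"
  using K_join_closed[of b a e d] assms by (simp add: meet_comm)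

text \<open>
  The lattice of \<open>K_algebra A\<close> is a sublattice of the product of \<open>A\<close> with its dual, and
  \<open>kan_neg\<close> only depends on the first component. Every axiom therefore reduces to laws
  of \<open>A\<close> in each component: (N1) and (N2) to \<open>meet_pcomp_meet\<close> and
  \<open>pcomp_join\<close>, (N3), (N4) and the Kleene inequality to the disjointness of the two
  components.
\<close>

lemma K_algebra_centered_stone_kan: "centered_stone_kan_algebra (K_algebra A)"
proof (unfold_locales, goal_cases)
  case (3 x y)
  then show ?case by (cases x; cases y) (simp add: K_carrier_iff K_join_closed)
next
  case (4 x y)
  then show ?case by (cases x; cases y) (simp add: K_carrier_iff K_meet_closed)
next
  case (5 x y)
  then show ?case by (cases x; cases y) (simp add: K_carrier_iff meet_comm join_comm)
next
  case (6 x y)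
  then show ?case by (cases x; cases y) (simp add: K_carrier_iff meet_comm join_comm)
next
  case (7 x y z)
  then show ?case
    by (cases x; cases y; cases z) (simp add: K_carrier_iff meet_assoc join_assoc)
next
  case (8 x y z)
  then show ?case
    by (cases x; cases y; cases z) (simp add: K_carrier_iff meet_assoc join_assoc)
next
  case (9 x y)
  then show ?case by (cases x; cases y) (simp add: K_carrier_iff meet_absorb join_absorb)
next
  case (10 x y)
  then show ?case by (cases x; cases y) (simp add: K_carrier_iff meet_absorb join_absorb)
next
  case (11 x y z)
  then show ?case
    by (cases x; cases y; cases z)
      (auto simp: K_carrier_iff intro: meet_join_distrib join_meet_distrib)
next
  case (17 x y)
  then show ?case by (cases x; cases y) (auto simp: K_carrier_iff lat_le_def meet_comm)
next
  case (19 x y)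
  then show ?case by (cases x; cases y) (simp add: K_carrier_iff meet_pcomp_meet)
next
  case (20 x y)
  then show ?case by (cases x; cases y) (simp add: K_carrier_iff pcomp_join)
next
  case (22 x)
  then show ?case
    by (cases x) (simp add: K_carrier_iff lat_le_def le_pcomp_iff[unfolded lat_le_def] meet_comm)
qed (auto simp: K_carrier_iff lat_le_def meet_pcomp meet_comm join_comm stone)

end

section \<open>The Stone algebra of fixed points of the interior operator\<close>

context kan_algebra
begin

lemmas kan_closed [simp] = inv_closed neg_closed
lemmas inv_inv_simp [simp] = inv_inv

lemma inv_meet:
  "\<lbrakk>x \<in> carrier T; y \<in> carrier T\<rbrakk> \<Longrightarrow> \<sim> (x \<sqinter> y) = \<sim> x \<squnion> \<sim> y"
  using inv_join[of "\<sim> x" "\<sim> y"] inv_inv[of "\<sim> x \<squnion> \<sim> y"] by simp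

lemma inv_top [simp]: "\<sim> \<top> = \<bottom>"
  using inv_join[of "\<sim> \<bottom>" \<top>] by simp

lemma inv_bottom [simp]: "\<sim> \<bottom> = \<top>"
  by (metis inv_inv inv_top top_closed)

lemma neg_top [simp]: "\<rightharpoondown> \<top> = \<bottom>"
  using N3[of \<top>] by simp

lemma neg_bottom [simp]: "\<rightharpoondown> \<bottom> = \<top>"
  using N4[of \<bottom>] by (simp add: lat_le_def)

lemma dia_closed [simp]: "x \<in> carrier T \<Longrightarrow> \<diamond> x \<in> carrier T"
  by (simp add: dia_def)

lemma dia_top [simp]: "\<diamond> \<top> = \<top>"
  by (simp add: dia_def)

lemma dia_bottom [simp]: "\<diamond> \<bottom> = \<bottom>"
  by (simp add: dia_def)

lemma dia_eq_iff_neg_eq: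
  "\<lbrakk>x \<in> carrier T; y \<in> carrier T\<rbrakk> \<Longrightarrow> \<diamond> x = \<diamond> y \<longleftrightarrow> \<rightharpoondown> x = \<rightharpoondown> y"
  unfolding dia_def by (metis inv_inv neg_closed)

lemma dia_join:
  "\<lbrakk>x \<in> carrier T; y \<in> carrier T\<rbrakk> \<Longrightarrow> \<diamond> (x \<squnion> y) = \<diamond> x \<squnion> \<diamond> y"
  by (simp add: dia_def N2 inv_meet)

lemma neg_dia [simp]: "x \<in> carrier T \<Longrightarrow> \<rightharpoondown> (\<diamond> x) = \<rightharpoondown> x"
  using N5[of x \<top>] by (simp add: dia_def)

lemma dia_dia [simp]: "x \<in> carrier T \<Longrightarrow> \<diamond> (\<diamond> x) = \<diamond> x"
  by (simp add: dia_eq_iff_neg_eq)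

lemma dia_le:
  assumes "x \<in> carrier T"
  shows "\<diamond> x \<sqsubseteq> x"
proof -
  have "\<sim> x \<squnion> \<rightharpoondown> x = \<rightharpoondown> x"
    using N4[OF assms] assms by (simp add: le_iff_join)
  then have "\<sim> (\<sim> x \<squnion> \<rightharpoondown> x) = \<sim> (\<rightharpoondown> x)" by simp
  then have "x \<sqinter> \<diamond> x = \<diamond> x"
    using assms by (simp add: dia_def inv_join)
  then show ?thesis
    using assms by (simp add: lat_le_def meet_comm)
qed

lemma dia_meet_dia:
  assumes "x \<in> carrier T" "y \<in> carrier T"
  shows "\<diamond> (\<diamond> x \<sqinter> y) = \<diamond> (x \<sqinter> y)" and "\<diamond> (x \<sqinter> \<diamond> y) = \<diamond> (x \<sqinter> y)"
proof -
  have *: "\<diamond> (\<diamond> x \<sqinter> y) = \<diamond> (x \<sqinter> y)" if "x \<in> carrier T" "y \<in> carrier T" for x y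
    unfolding dia_def using N5 that by simp
  from assms show "\<diamond> (\<diamond> x \<sqinter> y) = \<diamond> (x \<sqinter> y)" by (rule *)
  from *[of y x] assms show "\<diamond> (x \<sqinter> \<diamond> y) = \<diamond> (x \<sqinter> y)"
    by (simp add: meet_comm)
qed

lemma dia_eq_bottom_iff: "x \<in> carrier T \<Longrightarrow> \<diamond> x = \<bottom> \<longleftrightarrow> \<rightharpoondown> x = \<top>"
  using dia_eq_iff_neg_eq[of x \<bottom>] by simp

lemma dia_meet_neg:
  assumes "x \<in> carrier T"
  shows "\<diamond> (x \<sqinter> \<rightharpoondown> x) = \<bottom>"
  using N1[of x \<top>] assms by (simp add: dia_eq_bottom_iff)

text \<open>
  Modulo the congruence \<open>\<diamond> x = \<diamond> y\<close>, \<open>\<rightharpoondown> b\<close> is the pseudocomplement of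
  \<open>b\<close>. By (N1), \<open>a \<sqinter> \<rightharpoondown> b\<close> is always congruent to \<open>a \<sqinter> \<rightharpoondown> (a \<sqinter> b)\<close>, which is
  \<open>a\<close> as soon as \<open>a \<sqinter> b\<close> is congruent to the bottom element. The converse holds because
  \<open>b \<sqinter> \<rightharpoondown> b\<close> is congruent to the bottom element.
\<close>

lemma dia_meet_eq_bottom_iff:
  assumes [simp]: "a \<in> carrier T" "b \<in> carrier T"
  shows "\<diamond> (a \<sqinter> b) = \<bottom> \<longleftrightarrow> \<diamond> (a \<sqinter> \<rightharpoondown> b) = \<diamond> a"
proof
  assume "\<diamond> (a \<sqinter> b) = \<bottom>"
  then have "\<rightharpoondown> (a \<sqinter> b) = \<top>" by (simp add: dia_eq_bottom_iff)
  then show "\<diamond> (a \<sqinter> \<rightharpoondown> b) = \<diamond> a"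
    using N1[of a b] by (simp add: dia_eq_iff_neg_eq)
next
  assume *: "\<diamond> (a \<sqinter> \<rightharpoondown> b) = \<diamond> a"
  have "\<diamond> (a \<sqinter> b) = \<diamond> (\<diamond> (a \<sqinter> \<rightharpoondown> b) \<sqinter> b)"
    by (simp add: * dia_meet_dia)
  also have "\<dots> = \<diamond> (a \<sqinter> (b \<sqinter> \<rightharpoondown> b))"
    by (simp add: dia_meet_dia meet_assoc meet_comm[of "\<rightharpoondown> b"])
  also have "\<dots> = \<diamond> (a \<sqinter> \<diamond> (b \<sqinter> \<rightharpoondown> b))"
    by (simp add: dia_meet_dia)
  also have "\<dots> = \<bottom>"
    by (simp add: dia_meet_neg)
  finally show "\<diamond> (a \<sqinter> b) = \<bottom>" .
qed

lemma box_set_iff: "b \<in> box_set T \<longleftrightarrow> b \<in> carrier T \<and> \<rightharpoondown> (\<sim> b) = b"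
  by (simp add: box_set_def box_def)

lemma dia_set_iff: "a \<in> dia_set T \<longleftrightarrow> a \<in> carrier T \<and> \<diamond> a = a"
  by (simp add: dia_set_def)

lemma box_eq_inv_dia_inv: "x \<in> carrier T \<Longrightarrow> \<box> x = \<sim> (\<diamond> (\<sim> x))"
  by (simp add: box_def dia_def)

lemma inv_mem_dia_set_iff: "b \<in> carrier T \<Longrightarrow> \<sim> b \<in> dia_set T \<longleftrightarrow> b \<in> box_set T"
  unfolding dia_set_iff box_set_iff dia_def by (metis inv_closed inv_inv neg_closed)

text \<open>
  The order constraint on pairs in \<open>M_algebra T\<close> is disjointness in \<open>T\<^sup>\<diamond>\<close>. If
  \<open>a \<sqsubseteq> b\<close>, then \<open>a \<sqinter> \<sim> b\<close> lies below \<open>b \<sqinter> \<sim> b = \<sim> b \<sqinter> \<rightharpoondown> \<sim> b\<close>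
  by (N3), whose interior is the bottom element. Conversely, disjointness from \<open>\<sim> b\<close> makes
  \<open>a\<close> the interior of \<open>a \<sqinter> \<rightharpoondown> \<sim> b = a \<sqinter> b\<close>, hence an element below \<open>b\<close>.
\<close>

lemma le_iff_dia_meet_inv:
  assumes "a \<in> dia_set T" "b \<in> box_set T"
  shows "a \<sqsubseteq> b \<longleftrightarrow> \<diamond> (a \<sqinter> \<sim> b) = \<bottom>"
proof -
  from assms have [simp]: "a \<in> carrier T" "b \<in> carrier T" "\<diamond> a = a" "\<rightharpoondown> (\<sim> b) = b"
    by (auto simp: dia_set_iff box_set_iff)
  show ?thesis
  proof
    assume "a \<sqsubseteq> b"
    then have "a \<sqinter> \<sim> b = a \<sqinter> (b \<sqinter> \<sim> b)"
      by (simp add: lat_le_def meet_assoc[symmetric])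
    also have "b \<sqinter> \<sim> b = \<sim> b \<sqinter> \<rightharpoondown> (\<sim> b)"
      by (simp add: meet_comm[of b])
    finally have "\<diamond> (a \<sqinter> \<sim> b) = \<diamond> (a \<sqinter> \<diamond> (\<sim> b \<sqinter> \<rightharpoondown> (\<sim> b)))"
      by (simp only: dia_meet_dia(2) \<open>a \<in> carrier T\<close> kan_closed meet_closed \<open>b \<in> carrier T\<close>)
    also have "\<dots> = \<bottom>"
      by (simp only: dia_meet_neg inv_closed \<open>b \<in> carrier T\<close>) simp
    finally show "\<diamond> (a \<sqinter> \<sim> b) = \<bottom>" .
  next
    assume "\<diamond> (a \<sqinter> \<sim> b) = \<bottom>"
    then have "\<diamond> (a \<sqinter> b) = a"
      using dia_meet_eq_bottom_iff[of a "\<sim> b"] by simp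
    then have "a \<sqsubseteq> a \<sqinter> b"
      using dia_le[of "a \<sqinter> b"] by simp
    then show "a \<sqsubseteq> b" by (simp add: le_meet_iff)
  qed
qed

end

context stone_kan_algebra
begin

lemma dia_algebra_sel [simp]:
  "carrier (dia_algebra T) = dia_set T"
  "x \<squnion>\<^bsub>dia_algebra T\<^esub> y = x \<squnion> y"
  "x \<sqinter>\<^bsub>dia_algebra T\<^esub> y = \<diamond> (x \<sqinter> y)"
  "\<bottom>\<^bsub>dia_algebra T\<^esub> = \<bottom>"
  "\<top>\<^bsub>dia_algebra T\<^esub> = \<top>"
  "pcomp (dia_algebra T) x = \<diamond> (\<rightharpoondown> x)"
  by (simp_all add: dia_algebra_def)

text \<open>
  The meet is reduced to the meet of \<open>T\<close> by pulling \<open>\<diamond>\<close> out of nested meets, and the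
  join already is the join of \<open>T\<close>; so each lattice law is \<open>\<diamond>\<close> applied to a law of \<open>T\<close>.
\<close>

lemma dia_algebra_stone: "stone_algebra (dia_algebra T)"
proof (unfold_locales, goal_cases)
  case (5 x y)
  then show ?case by (simp add: dia_set_iff join_comm)
next
  case (6 x y)
  then show ?case by (simp add: dia_set_iff meet_comm)
next
  case (7 x y z)
  then show ?case by (simp add: dia_set_iff join_assoc)
next
  case (8 x y z)
  then show ?case by (simp add: dia_set_iff dia_meet_dia meet_assoc)
next
  case (9 x y)
  then have "x \<squnion> \<diamond> (x \<sqinter> y) = \<diamond> (x \<squnion> (x \<sqinter> y))"
    by (simp add: dia_set_iff dia_join)
  with 9 show ?case by (simp add: dia_set_iff join_absorb)
next
  case (10 x y)
  then show ?case by (simp add: dia_set_iff meet_absorb)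
next
  case (11 x y z)
  then show ?case by (simp add: dia_set_iff meet_join_distrib dia_join)
next
  case (15 a b)
  then show ?case
    by (simp add: dia_set_iff dia_meet_eq_bottom_iff lat_le_def dia_meet_dia)
next
  case (16 x)
  then show ?case by (simp add: dia_set_iff dia_join[symmetric] stone_neg)
qed (simp_all add: dia_set_iff dia_join lat_le_def)

end

section \<open>Transport of structure\<close>

text \<open>
  If each operation of \<open>A\<close> is the conjugate of the corresponding operation of \<open>B\<close>
  under a bijection \<open>h\<close> with inverse \<open>g\<close>, both closure of the carrier of \<open>A\<close> and all
  the identities follow from those of \<open>B\<close>. The assumptions are phrased with \<open>g\<close>, and not
  as homomorphism properties of \<open>h\<close>, so that closure is part of the conclusion.
\<close>

locale ckan_transport =
  fixes A :: "('a, 'm) ckan_alg_scheme" and B :: "('b, 'n) ckan_alg_scheme"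
    and h :: "'a \<Rightarrow> 'b" and g :: "'b \<Rightarrow> 'a"
  assumes B: "centered_stone_kan_algebra B"
    and h_mem: "x \<in> carrier A \<Longrightarrow> h x \<in> carrier B"
    and g_mem: "u \<in> carrier B \<Longrightarrow> g u \<in> carrier A"
    and g_h: "x \<in> carrier A \<Longrightarrow> g (h x) = x"
    and h_g: "u \<in> carrier B \<Longrightarrow> h (g u) = u"
    and join_eq: "\<lbrakk>x \<in> carrier A; y \<in> carrier A\<rbrakk> \<Longrightarrow> x \<squnion>\<^bsub>A\<^esub> y = g (h x \<squnion>\<^bsub>B\<^esub> h y)"
    and meet_eq: "\<lbrakk>x \<in> carrier A; y \<in> carrier A\<rbrakk> \<Longrightarrow> x \<sqinter>\<^bsub>A\<^esub> y = g (h x \<sqinter>\<^bsub>B\<^esub> h y)"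
    and inv_eq: "x \<in> carrier A \<Longrightarrow> \<sim>\<^bsub>A\<^esub> x = g (\<sim>\<^bsub>B\<^esub> (h x))"
    and neg_eq: "x \<in> carrier A \<Longrightarrow> \<rightharpoondown>\<^bsub>A\<^esub> x = g (\<rightharpoondown>\<^bsub>B\<^esub> (h x))"
    and bottom_eq: "\<bottom>\<^bsub>A\<^esub> = g \<bottom>\<^bsub>B\<^esub>"
    and top_eq: "\<top>\<^bsub>A\<^esub> = g \<top>\<^bsub>B\<^esub>"
    and center_eq: "\<cc>\<^bsub>A\<^esub> = g \<cc>\<^bsub>B\<^esub>"
begin

interpretation B: centered_stone_kan_algebra B
  by (rule B)

lemmas transport_simps = h_mem g_mem g_h h_g join_eq meet_eq inv_eq neg_eq
  bottom_eq top_eq center_eq B.center_closed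

lemma h_iso: "h \<in> ckan_iso A B"
proof -
  have "bij_betw h (carrier A) (carrier B)"
    by (rule bij_betwI[where g = g]) (auto simp: transport_simps)
  then show ?thesis
    by (simp add: ckan_iso_def transport_simps)
qed

lemma transport_le:
  "\<lbrakk>x \<in> carrier A; y \<in> carrier A\<rbrakk> \<Longrightarrow> x \<sqsubseteq>\<^bsub>A\<^esub> y \<longleftrightarrow> h x \<sqsubseteq>\<^bsub>B\<^esub> h y"
  unfolding lat_le_def by (metis B.meet_closed g_h h_g h_mem meet_eq)

lemma transport_centered_stone_kan: "centered_stone_kan_algebra A"
proof (unfold_locales, goal_cases)
  case (5 x y)
  then show ?case by (simp add: transport_simps B.join_comm)
next
  case (6 x y)
  then show ?case by (simp add: transport_simps B.meet_comm)
next
  case (7 x y z)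
  then show ?case by (simp add: transport_simps B.join_assoc)
next
  case (8 x y z)
  then show ?case by (simp add: transport_simps B.meet_assoc)
next
  case (9 x y)
  then show ?case by (simp add: transport_simps B.join_absorb)
next
  case (10 x y)
  then show ?case by (simp add: transport_simps B.meet_absorb)
next
  case (11 x y z)
  then show ?case by (simp add: transport_simps B.meet_join_distrib)
next
  case (16 x y)
  then show ?case by (simp add: transport_simps B.inv_join)
next
  case (17 x y)
  then show ?case by (simp add: transport_le transport_simps B.kleene)
next
  case (19 x y)
  then show ?case by (simp add: transport_simps B.N1)
next
  case (20 x y)
  then show ?case by (simp add: transport_simps B.N2)
next
  case (21 x)
  then show ?case by (simp add: transport_simps B.N3)
next
  case (23 x y)
  then have "\<rightharpoondown>\<^bsub>B\<^esub> (h x \<sqinter>\<^bsub>B\<^esub> h y) = \<rightharpoondown>\<^bsub>B\<^esub> ((\<sim>\<^bsub>B\<^esub> (\<rightharpoondown>\<^bsub>B\<^esub> (h x))) \<sqinter>\<^bsub>B\<^esub> h y)"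
    by (simp add: h_mem B.N5)
  with 23 show ?case by (simp add: transport_simps)
qed (simp_all add: transport_le transport_simps B.bottom_le B.le_top B.N4 B.inv_center
      B.stone_neg)

end

section \<open>The isomorphism\<close>

context stone_kan_algebra
begin

lemma M_sel:
  "(a, b) \<squnion>\<^bsub>M_algebra T\<^esub> (d, e) = (a \<squnion> d, \<box> (b \<squnion> e))"
  "(a, b) \<sqinter>\<^bsub>M_algebra T\<^esub> (d, e) = (\<diamond> (a \<sqinter> d), b \<sqinter> e)"
  "\<bottom>\<^bsub>M_algebra T\<^esub> = (\<bottom>, \<bottom>)"
  "\<top>\<^bsub>M_algebra T\<^esub> = (\<top>, \<top>)"
  "\<sim>\<^bsub>M_algebra T\<^esub> (a, b) = (\<sim> b, \<sim> a)"
  "\<rightharpoondown>\<^bsub>M_algebra T\<^esub> (a, b) = (\<diamond> (\<rightharpoondown> a), \<sim> a)"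
  "\<cc>\<^bsub>M_algebra T\<^esub> = (\<bottom>, \<top>)"
  by (simp_all add: M_algebra_def)

lemma M_carrier_iff:
  "(a, b) \<in> carrier (M_algebra T) \<longleftrightarrow> a \<in> dia_set T \<and> b \<in> box_set T \<and> a \<sqsubseteq> b"
  by (simp add: M_algebra_def)

lemma mem_K_iff_mem_M:
  assumes "a \<in> carrier T" "b \<in> carrier T"
  shows "(a, \<sim> b) \<in> carrier (K_algebra (dia_algebra T)) \<longleftrightarrow> (a, b) \<in> carrier (M_algebra T)"
proof -
  interpret D: stone_algebra "dia_algebra T" by (rule dia_algebra_stone)
  show ?thesis
    using assms by (auto simp: D.K_carrier_iff M_carrier_iff inv_mem_dia_set_iff le_iff_dia_meet_inv)
qed

text \<open>
  As \<open>\<sim>\<close> is an involution, the same map \<open>(a, b) \<mapsto> (a, \<sim> b)\<close> serves as the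
  isomorphism and as its inverse.
\<close>

lemma M_K_transport:
  "ckan_transport (M_algebra T) (K_algebra (dia_algebra T))
    (\<lambda>(a, b). (a, \<sim> b)) (\<lambda>(a, b). (a, \<sim> b))"
proof -
  interpret D: stone_algebra "dia_algebra T" by (rule dia_algebra_stone)
  have M_carrier: "a \<in> carrier T" "b \<in> carrier T" if "(a, b) \<in> carrier (M_algebra T)" for a b
    using that by (simp_all add: M_carrier_iff dia_set_iff box_set_iff)
  have K_carrier: "a \<in> carrier T" "b \<in> carrier T"
    if "(a, b) \<in> carrier (K_algebra (dia_algebra T))" for a b
    using that by (simp_all add: D.K_carrier_iff dia_set_iff)
  show ?thesis
  proof (rule ckan_transport.intro, goal_cases)
    case 1
    then show ?case by (rule D.K_algebra_centered_stone_kan)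
  next
    case (2 x)
    then show ?case by (cases x) (simp add: mem_K_iff_mem_M M_carrier)
  next
    case (3 u)
    then show ?case
      by (cases u) (simp add: K_carrier mem_K_iff_mem_M[of _ "\<sim> _", symmetric])
  next
    case (6 x y)
    then show ?case
      by (cases x; cases y)
        (auto dest!: M_carrier simp: M_sel inv_join box_eq_inv_dia_inv)
  next
    case (7 x y)
    then show ?case
      by (cases x; cases y) (auto dest!: M_carrier simp: M_sel inv_join)
  qed (auto dest: M_carrier K_carrier simp: M_sel)
qed

end

theorem theorem4p3:
  fixes T :: "('a, 'm) kan_alg_scheme"
  assumes "stone_kan_algebra T"
  shows "stone_algebra (dia_algebra T)
    \<and> centered_stone_kan_algebra (M_algebra T)
    \<and> centered_stone_kan_algebra (K_algebra (dia_algebra T))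
    \<and> ckan_isomorphic (M_algebra T) (K_algebra (dia_algebra T))"
proof -
  interpret stone_kan_algebra T by (rule assms)
  interpret D: stone_algebra "dia_algebra T" by (rule dia_algebra_stone)
  interpret ckan_transport "M_algebra T" "K_algebra (dia_algebra T)"
    "\<lambda>(a, b). (a, \<sim>\<^bsub>T\<^esub> b)" "\<lambda>(a, b). (a, \<sim>\<^bsub>T\<^esub> b)"
    by (rule M_K_transport)
  show ?thesis
    using dia_algebra_stone transport_centered_stone_kan D.K_algebra_centered_stone_kan h_iso
    unfolding ckan_isomorphic_def by blast
qed

end
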